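(* Let $n\geq 1$ and $r\geq 0$ be integers. The number $g_{(n,r)}$ of Gelfand-Tsetlin patterns over $\mathrm{gl}_n$ defined by the weight vector $w=(n,\,n-r,\,n-2r,\,\dots,\,n-r(n-1))$ (i.e. having $w$ as top row) is $g_{(n,r)}=(r+1)^{\binom{n}{2}}$.
   Context: A Gelfand-Tsetlin pattern (GT-pattern) over $\mathrm{gl}_n$ with top row $\lambda=(\lambda_{(n,1)},\dots,\lambda_{(n,n)})$ (a weakly decreasing integer vector) is a triangular array of integers $\lambda_{(k,i)}$, $1\leq i\leq k\leq n$, whose $n$-th row is $\lambda$ and which satisfies $\lambda_{(k,i)}\geq\lambda_{(k-1,i)}\geq\lambda_{(k,i+1)}$ for all $2\leq k\leq n$ and $1\leq i\leq k-1$. Entries may be negative. *)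

theory Defs
  imports "HOL-Library.FuncSet"
begin

definition gt_index :: "nat \<Rightarrow> (nat \<times> nat) set" where
  "gt_index n = {(k, i). 1 \<le> i \<and> i \<le> k \<and> k \<le> n}"

text \<open>
  An array is a function on pairs \<open>(k, i)\<close> that is \<open>undefined\<close> outside the triangle, so that
  distinct patterns are exactly distinct functions. Only the entries \<open>1, \<dots>, n\<close> of the top row
  \<open>w\<close> matter. That they are weakly decreasing need not be required separately: it follows
  from the interlacing inequalities, so the set is empty otherwise.
\<close>

definition gt_patterns :: "nat \<Rightarrow> (nat \<Rightarrow> int) \<Rightarrow> (nat \<times> nat \<Rightarrow> int) set" where
  "gt_patterns n w = {L \<in> extensional (gt_index n).
     (\<forall>i\<in>{1..n}. L (n, i) = w i) \<and>
     (\<forall>k\<in>{2..n}. \<forall>i\<in>{1..k - 1}.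
        L (k, i) \<ge> L (k - 1, i) \<and> L (k - 1, i) \<ge> L (k, i + 1))}"

definition gt_weight :: "nat \<Rightarrow> nat \<Rightarrow> nat \<Rightarrow> int" where
  "gt_weight n r i = int n - int r * (int i - 1)"

definition gt_number :: "nat \<Rightarrow> nat \<Rightarrow> nat" where
  "gt_number n r = card (gt_patterns n (gt_weight n r))"

end

theory Submission
  imports Defs "Jordan_Normal_Form.Determinant" "HOL-Computational_Algebra.Formal_Power_Series"
begin

text \<open>
  Read a weakly decreasing row \<open>w\<close> of length \<open>n\<close> from right to left and add the staircase: the
  numbers \<open>x i = w (n - i) + i\<close>, for \<open>0 \<le> i < n\<close>, are strictly increasing, and a row below \<open>w\<close>
  interlaces with \<open>w\<close> exactly when its own shifted entries \<open>m i\<close> satisfy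
  \<open>x i \<le> m i < x (i + 1)\<close>. So the \<open>m i\<close> range independently over half-open intervals.

  Hence the number of patterns with top row \<open>w\<close> is the determinant of the matrix of binomial
  coefficients \<open>x i gchoose j\<close> (\<open>card_gt_patterns_det\<close>; it is the Weyl dimension formula in
  determinant form). This goes by induction on \<open>n\<close>. The determinant is linear in each row, so
  summing it over all interlacing rows sums every entry over its own interval
  (\<open>sum_PiE_det\<close>); the sum of \<open>m gchoose j\<close> over \<open>x i \<le> m < x (i + 1)\<close> telescopes to
  \<open>(x (i + 1) gchoose (j + 1)) - (x i gchoose (j + 1))\<close>; and the determinant of these differences
  is the one of the next size, because its first column consists of ones
  (\<open>det_first_column_one\<close>).

  For the given weight the \<open>x i\<close> form an arithmetic progression of step \<open>r + 1\<close>. Expanding its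
  binomial coefficients by finite differences factors the matrix as a unitriangular one
  times a triangular one with diagonal entries \<open>(r + 1) ^ j\<close>
  (\<open>det_gbinomial_arith_progression\<close>), and \<open>0 + 1 + \<dots> + (n - 1)\<close> is \<open>n choose 2\<close>.
\<close>

section \<open>Determinants and binomial coefficients\<close>

text \<open>
  Every Leibniz term contains exactly one entry of each row, so by distributivity a sum over
  independent choices, one for each row, can be moved into the entries. The bijection \<open>h\<close> allows
  the choices to be indexed by another set than the rows; interlacing rows are indexed from 1
  and in the reverse order.
\<close>

lemma sum_PiE_det:
  fixes f :: "nat \<Rightarrow> 'a \<Rightarrow> nat \<Rightarrow> 'b::comm_ring_1"
    and h :: "nat \<Rightarrow> 'c"
  assumes h: "bij_betw h {0..<n} I" and S: "\<And>i. i \<in> I \<Longrightarrow> finite (S i)"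
  shows "(\<Sum>m\<in>PiE I S. det (mat n n (\<lambda>(i, j). f i (m (h i)) j)))
       = det (mat n n (\<lambda>(i, j). \<Sum>v\<in>S (h i). f i v j))"
proof -
  define h' where "h' = the_inv_into {0..<n} h"
  have h'h: "h' (h i) = i" if "i < n" for i
    using h that by (simp add: h'_def bij_betw_def the_inv_into_f_f)
  have fin: "finite I"
    using h bij_betw_finite by auto
  have leibniz: "det (mat n n (\<lambda>(i, j). F i j))
      = (\<Sum>p | p permutes {0..<n}. signof p * (\<Prod>i=0..<n. F i (p i)))" for F :: "nat \<Rightarrow> nat \<Rightarrow> 'b"
    unfolding det_def'[OF mat_carrier]
    by (intro sum.cong prod.cong refl arg_cong2[where f = "(*)"]) (auto dest: permutes_in_image)
  have reindex: "(\<Prod>i=0..<n. F i (h i)) = (\<Prod>k\<in>I. F (h' k) k)" for F :: "nat \<Rightarrow> 'c \<Rightarrow> 'b"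
    using prod.reindex_bij_betw[OF h, of "\<lambda>k. F (h' k) k"] by (simp add: h'h)
  have "(\<Sum>m\<in>PiE I S. det (mat n n (\<lambda>(i, j). f i (m (h i)) j)))
      = (\<Sum>m\<in>PiE I S. \<Sum>p | p permutes {0..<n}. signof p * (\<Prod>i=0..<n. f i (m (h i)) (p i)))"
    by (simp only: leibniz)
  also have "\<dots> = (\<Sum>p | p permutes {0..<n}. signof p *
      (\<Sum>m\<in>PiE I S. \<Prod>i=0..<n. f i (m (h i)) (p i)))"
    by (subst sum.swap) (simp add: sum_distrib_left)
  also have "\<dots> = (\<Sum>p | p permutes {0..<n}. signof p *
      (\<Prod>i=0..<n. \<Sum>v\<in>S (h i). f i v (p i)))"
  proof (intro sum.cong refl arg_cong2[where f = "(*)"])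
    fix p
    have "(\<Sum>m\<in>PiE I S. \<Prod>i=0..<n. f i (m (h i)) (p i))
        = (\<Sum>m\<in>PiE I S. \<Prod>k\<in>I. f (h' k) (m k) (p (h' k)))"
      by (intro sum.cong refl reindex[of "\<lambda>i k. f i (m k) (p i)" for m])
    also have "\<dots> = (\<Prod>k\<in>I. \<Sum>v\<in>S k. f (h' k) v (p (h' k)))"
      by (rule prod_sum_PiE[symmetric]) (use fin S in auto)
    also have "\<dots> = (\<Prod>i=0..<n. \<Sum>v\<in>S (h i). f i v (p i))"
      by (rule reindex[of "\<lambda>i k. \<Sum>v\<in>S k. f i v (p i)", symmetric])
    finally show "(\<Sum>m\<in>PiE I S. \<Prod>i=0..<n. f i (m (h i)) (p i))
        = (\<Prod>i=0..<n. \<Sum>v\<in>S (h i). f i v (p i))" .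
  qed
  also have "\<dots> = det (mat n n (\<lambda>(i, j). \<Sum>v\<in>S (h i). f i v j))"
    by (simp only: leibniz)
  finally show ?thesis .
qed

text \<open>
  Subtracting from each row the one above it turns the first column into a unit vector;
  expansion along that column leaves the matrix of differences.
\<close>

lemma det_first_column_one:
  fixes A :: "nat \<Rightarrow> nat \<Rightarrow> 'a::comm_ring_1"
  assumes one: "\<And>i. i \<le> n \<Longrightarrow> A i 0 = 1"
  shows "det (mat (Suc n) (Suc n) (\<lambda>(i, j). A i j))
       = det (mat n n (\<lambda>(i, j). A (Suc i) (Suc j) - A i (Suc j)))"
proof -
  let ?A = "mat (Suc n) (Suc n) (\<lambda>(i, j). A i j)"
  define L :: "'a mat" where
    "L = mat (Suc n) (Suc n) (\<lambda>(i, k). if k = i then 1 else if Suc k = i then - 1 else 0)"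
  define B where
    "B = mat (Suc n) (Suc n) (\<lambda>(i, j). case i of 0 \<Rightarrow> A 0 j | Suc i' \<Rightarrow> A i j - A i' j)"
  have car: "?A \<in> carrier_mat (Suc n) (Suc n)" "L \<in> carrier_mat (Suc n) (Suc n)"
    "B \<in> carrier_mat (Suc n) (Suc n)"
    by (auto simp: L_def B_def)
  (* Left multiplication by L subtracts from each row the one above it. *)
  have LA: "L * ?A = B"
  proof (rule eq_matI)
    fix i j assume "i < dim_row B" "j < dim_col B"
    then have ij: "i < Suc n" "j < Suc n" by (auto simp: B_def)
    have "(L * ?A) $$ (i, j) = (\<Sum>k=0..<Suc n. (if k = i then 1 else if Suc k = i then - 1 else 0) * A k j)"
      using ij by (simp add: L_def scalar_prod_def del: sum.op_ivl_Suc)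
    also have "\<dots> = (\<Sum>k=0..<Suc n. (if k = i then A k j else 0) + (if Suc k = i then - A k j else 0))"
      by (intro sum.cong) auto
    also have "\<dots> = B $$ (i, j)"
    proof (cases i)
      case 0
      then show ?thesis using ij by (simp add: B_def del: sum.op_ivl_Suc)
    next
      case (Suc i')
      then show ?thesis using ij by (simp add: B_def sum.distrib del: sum.op_ivl_Suc)
    qed
    finally show "(L * ?A) $$ (i, j) = B $$ (i, j)" .
  qed (auto simp: L_def B_def)
  have "det L = 1"
    by (subst det_lower_triangular[OF _ car(2)])
      (auto simp: L_def prod_list_diag_prod intro!: prod.neutral)
  then have "det ?A = det B"
    using det_mult[OF car(2,1)] LA by simp
  also have "det B = (\<Sum>i<Suc n. B $$ (i, 0) * cofactor B i 0)"
    using laplace_expansion_column[OF car(3)] by simp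
  also have "\<dots> = (\<Sum>i<Suc n. if i = 0 then cofactor B 0 0 else 0)"
    by (intro sum.cong) (auto simp: B_def one split: nat.split)
  also have "\<dots> = cofactor B 0 0"
    by simp
  also have "\<dots> = det (mat_delete B 0 0)"
    by (simp add: cofactor_def)
  also have "mat_delete B 0 0 = mat n n (\<lambda>(i, j). A (Suc i) (Suc j) - A i (Suc j))"
    by (rule eq_matI) (auto simp: mat_delete_def B_def)
  finally show ?thesis .
qed

text \<open>
  Row \<open>i\<close> has the generating function \<open>(1 + X) ^ c * ((1 + X) ^ d) ^ i\<close>, so its entry \<open>j\<close> is the
  coefficient of \<open>X ^ j\<close> in \<open>(1 + X) ^ c * (q + 1) ^ i\<close> with \<open>q = (1 + X) ^ d - 1\<close>. The binomial
  theorem for \<open>(q + 1) ^ i\<close> writes the matrix as a product. As \<open>q = d X + \<dots>\<close> has no constant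
  term, \<open>q ^ k\<close> starts with \<open>d ^ k X ^ k\<close>, which makes both factors triangular.
\<close>

lemma det_gbinomial_arith_progression:
  fixes c :: "'a::field_char_0"
  shows "det (mat n n (\<lambda>(i, j). (c + of_nat d * of_nat i) gchoose j)) = of_nat d ^ (n choose 2)"
proof -
  define q :: "'a fps" where "q = (1 + fps_X) ^ d - 1"
  define t where "t k j = fps_nth (fps_binomial c * q ^ k) j" for k j
  let ?A = "mat n n (\<lambda>(i, j). (c + of_nat d * of_nat i) gchoose j)"
  let ?B = "mat n n (\<lambda>(i, k). of_nat (i choose k)) :: 'a mat"
  let ?T = "mat n n (\<lambda>(k, j). t k j)"
  have q: "fps_nth q 0 = 0" "fps_nth q 1 = of_nat d"
    by (simp_all add: q_def flip: fps_binomial_of_nat)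
  have t_less: "t k j = 0" if "j < k" for j k
    using that startsby_zero_power_prefix[OF q(1), of k]
    by (auto simp: t_def fps_mult_nth intro!: sum.neutral)
  have t_diag: "t j j = of_nat d ^ j" for j
  proof -
    have "t j j = (\<Sum>i=0..j. if i = 0 then fps_nth (q ^ j) j else 0)"
      using startsby_zero_power_prefix[OF q(1), of j]
      unfolding t_def fps_mult_nth by (intro sum.cong) auto
    also have "\<dots> = of_nat d ^ j"
      using startsby_zero_power_nth_same[OF q(1)] q(2) by simp
    finally show ?thesis .
  qed
  have expand: "(c + of_nat d * of_nat i) gchoose j = (\<Sum>k\<le>i. of_nat (i choose k) * t k j)" for i j
  proof -
    have "fps_binomial (c + of_nat d * of_nat i) = fps_binomial c * (q + 1) ^ i"
      by (simp add: q_def fps_binomial_add_mult fps_binomial_of_nat power_mult flip: of_nat_mult)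
    also have "\<dots> = (\<Sum>k\<le>i. fps_const (of_nat (i choose k)) * (fps_binomial c * q ^ k))"
      by (simp add: binomial_ring sum_distrib_left fps_of_nat mult_ac)
    finally have "fps_nth (fps_binomial (c + of_nat d * of_nat i)) j
        = fps_nth (\<Sum>k\<le>i. fps_const (of_nat (i choose k)) * (fps_binomial c * q ^ k)) j"
      by simp
    then show ?thesis
      by (simp add: fps_sum_nth t_def)
  qed
  have "?A = ?B * ?T"
  proof (rule eq_matI)
    fix i j assume "i < dim_row (?B * ?T)" "j < dim_col (?B * ?T)"
    then have ij: "i < n" "j < n" by auto
    have "(\<Sum>k\<le>i. of_nat (i choose k) * t k j) = (\<Sum>k=0..<n. of_nat (i choose k) * t k j)"
      using ij by (intro sum.mono_neutral_left) (auto simp: binomial_eq_0)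
    then show "?A $$ (i, j) = (?B * ?T) $$ (i, j)"
      using ij by (simp add: expand scalar_prod_def)
  qed auto
  then have "det ?A = det ?B * det ?T"
    by (simp add: det_mult[of _ n])
  also have "det ?B = 1"
    by (subst det_lower_triangular[of n]) (auto simp: prod_list_diag_prod)
  also have "det ?T = (\<Prod>j=0..<n. of_nat d ^ j)"
    by (subst det_upper_triangular[of _ n])
      (auto simp: prod_list_diag_prod t_less t_diag upper_triangular_def)
  also have "\<dots> = of_nat d ^ (\<Sum>j=0..<n. j)"
    by (simp add: power_sum)
  also have "(\<Sum>j=0..<n. j) = n choose 2"
    by (induction n) (simp_all add: numeral_2_eq_2)
  finally show ?thesis by simp
qed

lemma sum_gbinomial_atLeastLessThan_int:
  fixes a b :: int
  assumes "a \<le> b"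
  shows "(\<Sum>m=a..<b. (of_int m :: 'a::field_char_0) gchoose j)
       = (of_int b gchoose Suc j) - (of_int a gchoose Suc j)"
  using assms
proof (induction b rule: int_ge_induct)
  case (step b)
  have "{a..<b + 1} = insert b {a..<b}" using step.hyps by auto
  then show ?case
    using step.IH by (simp add: gbinomial_Suc_Suc)
qed simp

section \<open>Counting patterns row by row\<close>

definition interlacing_rows :: "nat \<Rightarrow> (nat \<Rightarrow> int) \<Rightarrow> (nat \<Rightarrow> int) set" where
  "interlacing_rows n w = PiE {1..n} (\<lambda>i. {w (i + 1)..w i})"

lemma finite_interlacing_rows: "finite (interlacing_rows n w)"
  unfolding interlacing_rows_def by (intro finite_PiE) auto

lemma gt_patterns_0: "gt_patterns 0 w = {\<lambda>_. undefined}"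
  by (auto simp: gt_patterns_def gt_index_def extensional_def)

text \<open>
  Removing the top row of a pattern leaves a pattern whose own top row interlaces with it, and
  any such pattern can be extended. Row 1 can be removed in this way as well: the
  empty row interlaces with it vacuously, and both sides consist of a single element.
\<close>

lemma bij_betw_gt_patterns_Suc:
  "bij_betw (\<lambda>L. ((\<lambda>i\<in>{1..n}. L (n, i)), restrict L (gt_index n)))
     (gt_patterns (Suc n) w) (SIGMA \<mu>:interlacing_rows n w. gt_patterns n \<mu>)"
proof (rule bij_betwI[where g = "\<lambda>(\<mu>, L) p.
    if p \<in> gt_index n then L p else if p \<in> gt_index (Suc n) then w (snd p) else undefined"],
    goal_cases)
  case 1
  show ?case
  proof
    fix L assume L: "L \<in> gt_patterns (Suc n) w"
    then have top: "L (Suc n, i) = w i" if "1 \<le> i" "i \<le> Suc n" for i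
      using that by (auto simp: gt_patterns_def)
    have inter: "L (k, i) \<ge> L (k - 1, i)" "L (k - 1, i) \<ge> L (k, i + 1)"
      if "2 \<le> k" "k \<le> Suc n" "1 \<le> i" "i \<le> k - 1" for k i
      using L that by (auto simp: gt_patterns_def)
    have "(\<lambda>i\<in>{1..n}. L (n, i)) \<in> interlacing_rows n w"
      using inter[of "Suc n"] top by (fastforce simp: interlacing_rows_def)
    moreover have "restrict L (gt_index n) \<in> gt_patterns n (\<lambda>i\<in>{1..n}. L (n, i))"
      using inter by (auto simp: gt_patterns_def gt_index_def)
    ultimately show "((\<lambda>i\<in>{1..n}. L (n, i)), restrict L (gt_index n))
        \<in> (SIGMA \<mu>:interlacing_rows n w. gt_patterns n \<mu>)"
      by simp
  qed
next
  case 2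
  show ?case
  proof (safe, goal_cases)
    case (1 \<mu> L)
    then have \<mu>: "w (i + 1) \<le> \<mu> i" "\<mu> i \<le> w i" if "1 \<le> i" "i \<le> n" for i
      using that by (auto simp: interlacing_rows_def PiE_iff)
    have L: "L (n, i) = \<mu> i" if "1 \<le> i" "i \<le> n" for i
      using 1 that by (auto simp: gt_patterns_def)
    have inter: "L (k, i) \<ge> L (k - 1, i)" "L (k - 1, i) \<ge> L (k, i + 1)"
      if "2 \<le> k" "k \<le> n" "1 \<le> i" "i \<le> k - 1" for k i
      using 1 that by (auto simp: gt_patterns_def)
    define L' where "L' p = (if p \<in> gt_index n then L p
      else if p \<in> gt_index (Suc n) then w (snd p) else undefined)" for p
    have top: "L' (Suc n, i) = w i" if "1 \<le> i" "i \<le> Suc n" for i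
      using that by (simp add: L'_def gt_index_def)
    have below: "L' (k, i) = L (k, i)" if "1 \<le> i" "i \<le> k" "k \<le> n" for k i
      using that by (simp add: L'_def gt_index_def)
    have "L' (k, i) \<ge> L' (k - 1, i) \<and> L' (k - 1, i) \<ge> L' (k, i + 1)"
      if "2 \<le> k" "k \<le> Suc n" "1 \<le> i" "i \<le> k - 1" for k i
    proof (cases "k = Suc n")
      case True
      then show ?thesis using that top[of i] top[of "i + 1"] below[of i n] L[of i] \<mu>[of i] by simp
    next
      case False
      then show ?thesis
        using that inter[of k i] below[of i k] below[of "i + 1" k] below[of i "k - 1"] by simp
    qed
    moreover have "L' \<in> extensional (gt_index (Suc n))"
      by (auto simp: L'_def extensional_def gt_index_def)
    ultimately have "L' \<in> gt_patterns (Suc n) w"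
      using top by (simp add: gt_patterns_def)
    then show ?case
      by (simp add: L'_def [abs_def])
  qed
next
  case (3 L)
  then show ?case
    by (auto simp: gt_patterns_def gt_index_def fun_eq_iff extensional_def le_Suc_eq)
next
  case (4 y)
  then obtain \<mu> L where y: "y = (\<mu>, L)" "\<mu> \<in> interlacing_rows n w" "L \<in> gt_patterns n \<mu>"
    by auto
  then have "\<mu> i = L (n, i)" if "1 \<le> i" "i \<le> n" for i
    using that by (simp add: gt_patterns_def)
  with y show ?case
    by (auto simp: gt_patterns_def gt_index_def interlacing_rows_def fun_eq_iff extensional_def PiE_def)
qed

lemma finite_gt_patterns: "finite (gt_patterns n w)"
proof (induction n arbitrary: w)
  case (Suc n)
  then show ?case
    using bij_betw_finite[OF bij_betw_gt_patterns_Suc] finite_interlacing_rows by blast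
qed (simp add: gt_patterns_0)

lemma card_gt_patterns_Suc:
  "card (gt_patterns (Suc n) w) = (\<Sum>\<mu>\<in>interlacing_rows n w. card (gt_patterns n \<mu>))"
  using bij_betw_same_card[OF bij_betw_gt_patterns_Suc]
  by (simp add: finite_gt_patterns finite_interlacing_rows)

text \<open>
  The Weyl dimension formula for the general linear group, as a determinant. The
  hypothesis keeps the end points of all intervals of summation in order: over an empty interval
  with end points in the wrong order, the sum is 0 and not the telescoped difference.
\<close>

theorem card_gt_patterns_det:
  assumes "\<And>i. 1 \<le> i \<Longrightarrow> i < n \<Longrightarrow> w (i + 1) \<le> w i"
  shows "of_nat (card (gt_patterns n w))
       = det (mat n n (\<lambda>(i, j). (of_int (w (n - i) + int i) :: 'a::field_char_0) gchoose j))"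
  using assms
proof (induction n arbitrary: w)
  case 0
  then show ?case by (simp add: gt_patterns_0)
next
  case (Suc n)
  define x where "x i = w (Suc n - i) + int i" for i
  have IH: "of_nat (card (gt_patterns n \<mu>))
      = det (mat n n (\<lambda>(i, j). (of_int (\<mu> (n - i) + int i) :: 'a) gchoose j))"
    if \<mu>: "\<mu> \<in> interlacing_rows n w" for \<mu>
  proof (rule Suc.IH)
    fix i assume i: "1 \<le> i" "i < n"
    have "\<mu> (i + 1) \<le> w (i + 1)" "w (i + 1) \<le> \<mu> i"
      using i PiE_mem[OF \<mu>[unfolded interlacing_rows_def], of "i + 1"]
        PiE_mem[OF \<mu>[unfolded interlacing_rows_def], of i] by auto
    then show "\<mu> (i + 1) \<le> \<mu> i" by simp
  qed
  have bij: "bij_betw (\<lambda>i. n - i) {0..<n} {1..n}"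
    by (rule bij_betwI[where g = "\<lambda>i. n - i"]) auto
  (* The staircase adds i at the lower end and i + 1 at the upper end, which turns the closed
     interval of the entry into the half-open one that telescopes. *)
  have telescope: "(\<Sum>v\<in>{w (n - i + 1)..w (n - i)}. (of_int (v + int i) :: 'a) gchoose j)
      = (of_int (x (Suc i)) gchoose Suc j) - (of_int (x i) gchoose Suc j)" if "i < n" for i j
  proof -
    have "w (n - i + 1) \<le> w (n - i)"
      by (rule Suc.prems) (use that in auto)
    then have "x i \<le> x (Suc i)"
      using that by (simp add: x_def Suc_diff_le)
    moreover have "(\<Sum>v\<in>{w (n - i + 1)..w (n - i)}. (of_int (v + int i) :: 'a) gchoose j)
        = (\<Sum>m=x i..<x (Suc i). of_int m gchoose j)"
      by (rule sum.reindex_bij_witness[where j = "\<lambda>v. v + int i" and i = "\<lambda>m. m - int i"])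
        (use that in \<open>auto simp: x_def Suc_diff_le\<close>)
    ultimately show ?thesis
      by (simp only: sum_gbinomial_atLeastLessThan_int)
  qed
  have "of_nat (card (gt_patterns (Suc n) w))
      = (\<Sum>\<mu>\<in>interlacing_rows n w. (of_nat (card (gt_patterns n \<mu>)) :: 'a))"
    by (simp add: card_gt_patterns_Suc)
  also have "\<dots> = (\<Sum>\<mu>\<in>interlacing_rows n w.
      det (mat n n (\<lambda>(i, j). (of_int (\<mu> (n - i) + int i) :: 'a) gchoose j)))"
    by (intro sum.cong refl IH)
  also have "\<dots> = det (mat n n (\<lambda>(i, j).
      \<Sum>v\<in>{w (n - i + 1)..w (n - i)}. (of_int (v + int i) :: 'a) gchoose j))"
    unfolding interlacing_rows_def
    by (rule sum_PiE_det[OF bij, where f = "\<lambda>i v j. of_int (v + int i) gchoose j"]) auto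
  also have "\<dots> = det (mat n n (\<lambda>(i, j).
      (of_int (x (Suc i)) gchoose Suc j) - (of_int (x i) gchoose Suc j) :: 'a))"
    by (rule arg_cong[where f = det], rule cong_mat) (use telescope in auto)
  also have "\<dots> = det (mat (Suc n) (Suc n) (\<lambda>(i, j). (of_int (x i) :: 'a) gchoose j))"
    by (subst det_first_column_one) auto
  finally show ?case
    by (simp only: x_def)
qed

theorem theorem4:
  fixes n r :: nat
  assumes "n \<ge> 1"
  shows "gt_number n r = (r + 1) ^ (n choose 2)"
proof -
  have "of_nat (gt_number n r)
      = det (mat n n (\<lambda>(i, j). (of_int (gt_weight n r (n - i) + int i) :: rat) gchoose j))"
    unfolding gt_number_def
    by (rule card_gt_patterns_det) (auto simp: gt_weight_def algebra_simps)
  also have "\<dots> = det (mat n n (\<lambda>(i, j).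
      (of_int (gt_weight n r n) + of_nat (r + 1) * of_nat i :: rat) gchoose j))"
    by (rule arg_cong[where f = det], rule cong_mat)
      (auto simp: gt_weight_def of_nat_diff algebra_simps)
  also have "\<dots> = of_nat ((r + 1) ^ (n choose 2))"
    by (subst det_gbinomial_arith_progression) simp
  finally show ?thesis
    by (simp only: of_nat_eq_iff)
qed

end
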